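(* Let $\alpha\in(0,1)\cup(1,\infty)$ and suppose that all buyers in the Fisher market have CES utilities with the common elasticity $\rho_j=\rho=(\alpha-1)/\alpha$. Then the equilibrium price vector of the market coincides with the classical Augustin mean of order $\alpha$: a vector $p_\star$ is an equilibrium price vector (i.e. it has strictly positive entries and $x(p_\star)=\mathbf{1}_d$) if and only if $$p_\star\in\operatorname*{arg\,min}_{p\in\Delta_d}\ \sum_{j=1}^n w[j]\frac{1}{\alpha-1}\log\left(\left\langle a_j^{\alpha},p^{1-\alpha}\right\rangle\right).$$
   Context: Fisher market with $n$ buyers and $d$ goods (one unit of each good). Buyer $j$ has budget $w[j]>0$, with $\sum_{j=1}^n w[j]=1$, and CES utility $u_j(x)=\langle a_j,x^{\rho_j}\rangle^{1/\rho_j}$ on $\mathbb{R}_+^d$ with elasticity $\rho_j\in(-\infty,0)\cup(0,1)$, where $a_j\in\Delta_d$ (the probability simplex in $\mathbb{R}^d$) and $\sum_{j=1}^n a_j$ has all entries strictly positive. Powers of vectors are coordinate-wise, $\odot$ is the coordinate-wise product, $\mathbf{1}_d$ is the all-ones vector. For a price vector $p$ with strictly positive entries, the total demand vector is $$x(p)=\sum_{j=1}^n w[j]\frac{a_j^{1/(1-\rho_j)}\odot p^{-1/(1-\rho_j)}}{\left\langle a_j^{1/(1-\rho_j)},p^{-\rho_j/(1-\rho_j)}\right\rangle}.$$ In the minimization problem, the term $\frac{1}{\alpha-1}\log\left(\sum_i a_j[i]^\alpha p[i]^{1-\alpha}\right)$ is taken to be $+\infty$ when $\alpha<1$ and the sum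 is $0$, or when $\alpha>1$ and $p[i]=0<a_j[i]$ for some $i$; when $\alpha>1$, terms with $a_j[i]=p[i]=0$ are $0$. *)

theory Defs
  imports "HOL-Analysis.Analysis"
begin

text \<open>
  Goods are indexed by a finite type \<open>'d\<close> and buyers by a finite type \<open>'n\<close>. On \<open>real ^ 'd\<close>,
  the library product \<open>x * y\<close> is coordinate-wise and \<open>1\<close> is the all-ones vector.
\<close>

definition prob_simplex :: "(real ^ 'd) set" where
  "prob_simplex = {x. (\<forall>i. 0 \<le> x $ i) \<and> (\<Sum>i\<in>UNIV. x $ i) = 1}"

text \<open>
  As \<open>0 powr s = 0\<close> for every \<open>s\<close>, a zero coordinate is treated as \<open>0\<close> even for negative
  exponents. Below this matters only in \<open>renyi_term\<close>, which handles that case explicitly.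
\<close>

definition vpowr :: "real ^ 'd \<Rightarrow> real \<Rightarrow> real ^ 'd" (infixr "vpowr" 80) where
  "x vpowr s = (\<chi> i. x $ i powr s)"

text \<open>
  Budgets \<open>w\<close>, elasticities \<open>\<rho>\<close> and coefficients \<open>a\<close>: buyer \<open>j\<close> has the CES utility whose value
  at \<open>x\<close> is \<open>(a j \<bullet> (x vpowr \<rho> $ j)) powr (1 / \<rho> $ j)\<close>. The utilities enter
  through the resulting closed form of \<open>total_demand\<close>.
\<close>

definition ces_fisher_market ::
  "real ^ 'n \<Rightarrow> real ^ 'n \<Rightarrow> ('n \<Rightarrow> real ^ 'd) \<Rightarrow> bool" where
  "ces_fisher_market w \<rho> a \<longleftrightarrow>
     (\<forall>j. 0 < w $ j) \<and> (\<Sum>j\<in>UNIV. w $ j) = 1 \<and>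
     (\<forall>j. \<rho> $ j \<in> {..<0} \<union> {0<..<1}) \<and>
     (\<forall>j. a j \<in> prob_simplex) \<and>
     (\<forall>i. 0 < (\<Sum>j\<in>UNIV. a j) $ i)"

definition total_demand ::
  "real ^ 'n \<Rightarrow> real ^ 'n \<Rightarrow> ('n \<Rightarrow> real ^ 'd) \<Rightarrow> real ^ 'd \<Rightarrow> real ^ 'd" where
  "total_demand w \<rho> a p =
     (\<Sum>j\<in>UNIV.
        (w $ j / ((a j vpowr (1 / (1 - \<rho> $ j))) \<bullet> (p vpowr (- \<rho> $ j / (1 - \<rho> $ j)))))
        *\<^sub>R ((a j vpowr (1 / (1 - \<rho> $ j))) * (p vpowr (- 1 / (1 - \<rho> $ j)))))"

definition equilibrium_price ::
  "real ^ 'n \<Rightarrow> real ^ 'n \<Rightarrow> ('n \<Rightarrow> real ^ 'd) \<Rightarrow> real ^ 'd \<Rightarrow> bool" where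
  "equilibrium_price w \<rho> a p \<longleftrightarrow> (\<forall>i. 0 < p $ i) \<and> total_demand w \<rho> a p = 1"

text \<open>
  The Renyi divergence of order \<open>\<alpha>\<close>, with its value \<open>\<infinity>\<close> made explicit. In the remaining case
  with \<open>\<alpha> > 1\<close>, coordinates with \<open>a $ i = p $ i = 0\<close> contribute \<open>0\<close> to the inner product, because
  \<open>0 powr s = 0\<close>.
\<close>

definition renyi_term :: "real \<Rightarrow> real ^ 'd \<Rightarrow> real ^ 'd \<Rightarrow> ereal" where
  "renyi_term \<alpha> a p =
     (if (\<alpha> < 1 \<and> (a vpowr \<alpha>) \<bullet> (p vpowr (1 - \<alpha>)) = 0) \<or>
         (\<alpha> > 1 \<and> (\<exists>i. p $ i = 0 \<and> 0 < a $ i))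
      then \<infinity>
      else ereal (1 / (\<alpha> - 1) * ln ((a vpowr \<alpha>) \<bullet> (p vpowr (1 - \<alpha>)))))"

definition augustin_objective ::
  "real \<Rightarrow> real ^ 'n \<Rightarrow> ('n \<Rightarrow> real ^ 'd) \<Rightarrow> real ^ 'd \<Rightarrow> ereal" where
  "augustin_objective \<alpha> w a p = (\<Sum>j\<in>UNIV. ereal (w $ j) * renyi_term \<alpha> (a j) p)"

definition is_augustin_mean ::
  "real \<Rightarrow> real ^ 'n \<Rightarrow> ('n \<Rightarrow> real ^ 'd) \<Rightarrow> real ^ 'd \<Rightarrow> bool" where
  "is_augustin_mean \<alpha> w a p \<longleftrightarrow>
     is_arg_min (augustin_objective \<alpha> w a) (\<lambda>q. q \<in> prob_simplex) p"

end

theory Submission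
  imports Defs "HOL-Real_Asymp.Real_Asymp"
begin

text \<open>
  On the positive orthant the gradient of the Augustin objective is minus the total demand \<open>x(p)\<close>,
  and \<open>\<langle>p, x(p)\<rangle> = 1\<close> by Walras' law. If \<open>x(p)\<close> is the all-ones vector, then \<open>p\<close> sums to one and the
  gradient is constant along the simplex, so the gradient inequality for the (convex) objective
  makes \<open>p\<close> a minimizer. Conversely, at a positive minimizer the derivative along
  \<open>p \<odot> (x(p) - 1)\<close>, which is \<open>- (\<Sum>i. p[i] (x(p)[i] - 1)\<^sup>2)\<close>, vanishes. Minimizers are positive: for
  \<open>\<alpha> > 1\<close> because the objective is infinite elsewhere, and for \<open>\<alpha> < 1\<close> because increasing a
  zero coordinate to \<open>u\<close> gains at least a multiple of \<open>u powr (1 - \<alpha>)\<close>, while renormalizing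
  costs only \<open>ln (1 + u)\<close>.
\<close>

section \<open>Real-valued form of the objective and its finiteness domain\<close>

text \<open>Both the argument of the logarithm in \<open>renyi_term\<close> and, for the common
  elasticity, the denominator of the CES demand; this is where the two sides of the theorem
  meet.\<close>

definition renyi_sum :: "real \<Rightarrow> real ^ 'd \<Rightarrow> real ^ 'd \<Rightarrow> real" where
  "renyi_sum \<alpha> a p = (\<Sum>i\<in>UNIV. a $ i powr \<alpha> * p $ i powr (1 - \<alpha>))"

text \<open>For nonnegative vectors this says that the supports meet when \<alpha> < 1, and that the
  support of \<open>a\<close> lies in that of \<open>p\<close> when \<alpha> > 1.\<close>

definition renyi_finite :: "real \<Rightarrow> real ^ 'd \<Rightarrow> real ^ 'd \<Rightarrow> bool" where
  "renyi_finite \<alpha> a p \<longleftrightarrow>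
     (\<alpha> < 1 \<longrightarrow> renyi_sum \<alpha> a p \<noteq> 0) \<and> (\<alpha> > 1 \<longrightarrow> (\<forall>i. 0 < a $ i \<longrightarrow> p $ i \<noteq> 0))"

text \<open>A real function that can be differentiated; it represents the objective only where every
  term is finite.\<close>

definition real_objective :: "real \<Rightarrow> real ^ 'n \<Rightarrow> ('n \<Rightarrow> real ^ 'd) \<Rightarrow> real ^ 'd \<Rightarrow> real" where
  "real_objective \<alpha> w a p = (\<Sum>j\<in>UNIV. w $ j / (\<alpha> - 1) * ln (renyi_sum \<alpha> (a j) p))"

lemma prob_simplexD:
  assumes "x \<in> prob_simplex"
  shows "\<And>i. 0 \<le> x $ i" and "(\<Sum>i\<in>UNIV. x $ i) = 1"
  using assms by (auto simp: prob_simplex_def)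

lemma prob_simplex_pos_coord:
  assumes "x \<in> prob_simplex"
  obtains i where "0 < x $ i"
proof -
  have "0 < (\<Sum>i\<in>UNIV. x $ i)"
    using prob_simplexD(2)[OF assms] by simp
  then have "\<exists>i. x $ i > 0"
    by (metis (no_types, lifting) linorder_not_le sum_nonpos)
  then show ?thesis using that by blast
qed

lemma renyi_term_eq:
  "renyi_term \<alpha> a p =
     (if renyi_finite \<alpha> a p then ereal (1 / (\<alpha> - 1) * ln (renyi_sum \<alpha> a p)) else \<infinity>)"
  by (auto simp: renyi_term_def renyi_finite_def renyi_sum_def inner_vec_def vpowr_def)

lemma renyi_sum_pos_if_common_support:
  assumes "0 < a $ i" and "0 < p $ i"
  shows "0 < renyi_sum \<alpha> a p"
  unfolding renyi_sum_def using assms by (intro sum_pos2[of _ i]) auto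

text \<open>For \<alpha> < 1, finiteness excludes the value zero of a nonnegative sum. For \<alpha>
  > 1 it makes \<open>p\<close> positive on the support of \<open>a\<close>, which is
  nonempty.\<close>

lemma renyi_sum_pos:
  assumes "\<alpha> \<in> {0<..<1} \<union> {1<..}" and a: "a \<in> prob_simplex"
    and p: "\<And>i. 0 \<le> p $ i" and fin: "renyi_finite \<alpha> a p"
  shows "0 < renyi_sum \<alpha> a p"
proof (cases "\<alpha> < 1")
  case True
  have "0 \<le> renyi_sum \<alpha> a p"
    unfolding renyi_sum_def by (intro sum_nonneg) auto
  with True fin show ?thesis by (auto simp: renyi_finite_def)
next
  case False
  obtain i where i: "0 < a $ i" using prob_simplex_pos_coord[OF a] .
  then have "p $ i \<noteq> 0" using False assms(1) fin by (auto simp: renyi_finite_def)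
  then have "0 < p $ i" using p[of i] by simp
  with i show ?thesis by (rule renyi_sum_pos_if_common_support)
qed

lemma renyi_finite_if_pos:
  assumes "a \<in> prob_simplex" and "\<And>i. 0 < p $ i"
  shows "renyi_finite \<alpha> a p"
proof -
  obtain i where "0 < a $ i" using prob_simplex_pos_coord[OF assms(1)] .
  then have "0 < renyi_sum \<alpha> a p" using assms(2) by (rule renyi_sum_pos_if_common_support)
  then show ?thesis using assms(2) by (auto simp: renyi_finite_def less_le)
qed

text \<open>One infinite term, having positive weight, makes the whole sum infinite, as no term is
  \<open>-\<infinity>\<close>.\<close>

lemma augustin_objective_eq:
  assumes w: "\<forall>j. 0 < w $ j"
  shows "augustin_objective \<alpha> w a p =
    (if \<forall>j. renyi_finite \<alpha> (a j) p then ereal (real_objective \<alpha> w a p) else \<infinity>)"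
proof (cases "\<forall>j. renyi_finite \<alpha> (a j) p")
  case True
  then show ?thesis
    by (simp add: augustin_objective_def real_objective_def renyi_term_eq)
next
  case False
  then obtain j where "\<not> renyi_finite \<alpha> (a j) p" by blast
  then have "ereal (w $ j) * renyi_term \<alpha> (a j) p = \<infinity>"
    using w[rule_format, of j] by (simp add: renyi_term_eq)
  then have "augustin_objective \<alpha> w a p = \<infinity>"
    unfolding augustin_objective_def by (subst sum_Pinfty) auto
  with False show ?thesis by auto
qed

section \<open>First-order inequality for the Renyi divergence\<close>

text \<open>Concavity, with the tangent taken at 1: Young's inequality for \<open>t\<close> and 1
  with weights \<open>s\<close> and \<open>1 - s\<close>.\<close>

lemma powr_le_tangent:
  fixes s t :: real
  assumes "0 < s" "s < 1" "0 \<le> t"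
  shows "t powr s \<le> 1 + s * (t - 1)"
proof (cases "t = 0")
  case False
  with assms show ?thesis
    using Youngs_inequality_0[of s "1 - s" t 1] by (simp add: algebra_simps)
qed (use assms in auto)

text \<open>Jensen's inequality in a form where \<open>y i\<close> may be \<open>0\<close> at indices of weight \<open>0\<close>.\<close>

lemma weighted_ln_le_ln_sum:
  fixes u y :: "'i \<Rightarrow> real"
  assumes "finite A" and u: "\<And>i. i \<in> A \<Longrightarrow> 0 \<le> u i" and u1: "sum u A = 1"
    and y: "\<And>i. i \<in> A \<Longrightarrow> 0 < u i \<Longrightarrow> 0 < y i" and r: "0 < (\<Sum>i\<in>A. u i * y i)"
  shows "(\<Sum>i\<in>A. u i * ln (y i)) \<le> ln (\<Sum>i\<in>A. u i * y i)"
proof -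
  define r where "r = (\<Sum>i\<in>A. u i * y i)"
  \<comment> \<open>Tangent to the logarithm at the weighted mean \<open>r\<close>; its linear part
    averages to zero.\<close>
  have "u i * ln (y i) \<le> u i * (ln r + (y i / r - 1))" if i: "i \<in> A" for i
  proof (cases "u i = 0")
    case False
    then have "0 < y i" using y[OF i] u[OF i] by simp
    then have "ln (y i) - ln r \<le> y i / r - 1"
      using ln_le_minus_one[of "y i / r"] r by (simp add: r_def ln_div)
    then show ?thesis using u[OF i] by (intro mult_left_mono) auto
  qed auto
  then have "(\<Sum>i\<in>A. u i * ln (y i)) \<le> (\<Sum>i\<in>A. u i * (ln r + (y i / r - 1)))"
    by (rule sum_mono)
  also have "\<dots> = (\<Sum>i\<in>A. u i) * (ln r - 1) + (\<Sum>i\<in>A. u i * y i) / r"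
    by (simp add: algebra_simps sum.distrib sum_subtractf sum_distrib_left sum_divide_distrib)
  also have "\<dots> = ln r" using r u1 by (simp add: r_def)
  finally show ?thesis by (simp add: r_def)
qed

text \<open>First-order form of convexity in the second argument. Only the base point
  \<open>p\<close> must be positive, so \<open>q\<close> may lie on the boundary, where the
  objective need not be differentiable.\<close>

lemma renyi_term_gradient_inequality:
  assumes \<alpha>: "\<alpha> \<in> {0<..<1} \<union> {1<..}" and a: "a \<in> prob_simplex"
    and p: "\<And>i. 0 < p $ i" and q: "\<And>i. 0 \<le> q $ i" and fin: "renyi_finite \<alpha> a q"
  shows "ln (renyi_sum \<alpha> a p) / (\<alpha> - 1)
      - (\<Sum>i\<in>UNIV. a $ i powr \<alpha> * p $ i powr (- \<alpha>) / renyi_sum \<alpha> a p * (q $ i - p $ i))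
    \<le> ln (renyi_sum \<alpha> a q) / (\<alpha> - 1)"
proof -
  define S where "S = renyi_sum \<alpha> a p"
  have S: "0 < S"
    unfolding S_def using renyi_sum_pos[OF \<alpha> a] renyi_finite_if_pos[OF a p] p by (simp add: less_imp_le)
  have R: "0 < renyi_sum \<alpha> a q" by (rule renyi_sum_pos[OF \<alpha> a q fin])
  \<comment> \<open>With weights \<open>u\<close> of total one and ratios \<open>t\<close>, the
    increment of the term becomes
    \<open>ln (\<Sum>i. u i * t i powr (1 - \<alpha>)) / (\<alpha> - 1)\<close>, and the gradient
    pairing becomes the sum of \<open>u i * (t i - 1)\<close>.\<close>
  define u where "u i = a $ i powr \<alpha> * p $ i powr (1 - \<alpha>) / S" for i
  define t where "t i = q $ i / p $ i" for i
  have u0: "0 \<le> u i" for i using S by (simp add: u_def)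
  have u1: "sum u UNIV = 1"
    using S unfolding u_def S_def renyi_sum_def by (simp flip: sum_divide_distrib)
  have t0: "0 \<le> t i" for i using p[of i] q[of i] by (simp add: t_def)
  have r: "(\<Sum>i\<in>UNIV. u i * t i powr (1 - \<alpha>)) = renyi_sum \<alpha> a q / S"
    unfolding renyi_sum_def sum_divide_distrib
  proof (rule sum.cong)
    fix i show "u i * t i powr (1 - \<alpha>) = a $ i powr \<alpha> * q $ i powr (1 - \<alpha>) / S"
      using p[of i] q[of i] by (simp add: u_def t_def powr_divide)
  qed simp
  have lin: "(\<Sum>i\<in>UNIV. a $ i powr \<alpha> * p $ i powr (- \<alpha>) / S * (q $ i - p $ i)) = (\<Sum>i\<in>UNIV. u i * (t i - 1))"
  proof (rule sum.cong)
    fix i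
    have "p $ i powr (1 - \<alpha>) = p $ i * p $ i powr (- \<alpha>)"
      using p[of i] powr_add[of "p $ i" 1 "- \<alpha>"] by simp
    then show "a $ i powr \<alpha> * p $ i powr (- \<alpha>) / S * (q $ i - p $ i) = u i * (t i - 1)"
      using p[of i] S by (simp add: u_def t_def field_simps)
  qed simp
  have lnr: "ln (renyi_sum \<alpha> a q / S) = ln (renyi_sum \<alpha> a q) - ln S"
    using R S by (simp add: ln_div)
  have "- (\<Sum>i\<in>UNIV. u i * (t i - 1)) \<le> ln (renyi_sum \<alpha> a q / S) / (\<alpha> - 1)"
  proof (cases "\<alpha> < 1")
    case True
    with \<alpha> have s: "0 < 1 - \<alpha>" "1 - \<alpha> < 1" by auto
    \<comment> \<open>The outer logarithm is linearized first, then each power by its tangent at 1.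
      Dividing by the negative \<open>\<alpha> - 1\<close> reverses the bound.\<close>
    have "ln (renyi_sum \<alpha> a q / S) \<le> renyi_sum \<alpha> a q / S - 1"
      using R S by (intro ln_le_minus_one) simp
    also have "\<dots> \<le> (\<Sum>i\<in>UNIV. u i * (1 + (1 - \<alpha>) * (t i - 1))) - 1"
      unfolding r[symmetric]
      by (intro diff_right_mono sum_mono mult_left_mono powr_le_tangent s t0 u0)
    also have "\<dots> = (1 - \<alpha>) * (\<Sum>i\<in>UNIV. u i * (t i - 1))"
      using u1 by (simp add: distrib_left sum.distrib sum_distrib_left mult.left_commute)
    finally show ?thesis using s by (simp add: field_simps)
  next
    case False
    with \<alpha> have s: "0 < \<alpha> - 1" by auto
    \<comment> \<open>Finiteness at \<open>q\<close> ensures that every ratio of positive weight has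
      a genuine logarithm.\<close>
    have tpos: "0 < t i" if "0 < u i" for i
    proof -
      have "a $ i \<noteq> 0" using that by (auto simp: u_def)
      then have "0 < a $ i" using prob_simplexD(1)[OF a, of i] by simp
      then have "q $ i \<noteq> 0" using fin s by (auto simp: renyi_finite_def)
      then show ?thesis using p[of i] q[of i] by (simp add: t_def less_le)
    qed
    \<comment> \<open>Here the logarithm of each ratio is linearized, with the negative factor
      \<open>1 - \<alpha>\<close> reversing the bound; Jensen's inequality then moves the logarithm
      outside the sum.\<close>
    have "(1 - \<alpha>) * (\<Sum>i\<in>UNIV. u i * (t i - 1)) = (\<Sum>i\<in>UNIV. u i * ((1 - \<alpha>) * (t i - 1)))"
      by (simp add: sum_distrib_left mult.left_commute)
    also have "\<dots> \<le> (\<Sum>i\<in>UNIV. u i * ln (t i powr (1 - \<alpha>)))"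
    proof (rule sum_mono)
      fix i show "u i * ((1 - \<alpha>) * (t i - 1)) \<le> u i * ln (t i powr (1 - \<alpha>))"
      proof (cases "u i = 0")
        case False
        then have "0 < t i" using tpos u0[of i] by (simp add: less_le)
        then have "(1 - \<alpha>) * (t i - 1) \<le> ln (t i powr (1 - \<alpha>))"
          using s ln_le_minus_one[of "t i"] by (simp add: ln_powr mult_left_mono_neg)
        then show ?thesis using u0 by (intro mult_left_mono) auto
      qed simp
    qed
    also have "\<dots> \<le> ln (renyi_sum \<alpha> a q / S)"
      unfolding r[symmetric]
      by (rule weighted_ln_le_ln_sum) (use u0 u1 tpos R S r in \<open>auto simp: less_le\<close>)
    finally show ?thesis using s by (simp add: field_simps)
  qed
  then show ?thesis
    unfolding S_def[symmetric] lin lnr by (simp add: diff_divide_distrib)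
qed

section \<open>Demand under the common elasticity and Walras' law\<close>

text \<open>The choice of \<rho> gives \<open>1 / (1 - \<rho>) = \<alpha>\<close> and
  \<open>- \<rho> / (1 - \<rho>) = 1 - \<alpha>\<close>. At positive prices, each summand is minus a
  partial derivative of the weighted Renyi term.\<close>

lemma ces_demand_eq:
  assumes \<rho>: "\<forall>j. \<rho> $ j = (\<alpha> - 1) / \<alpha>" and \<alpha>: "0 < \<alpha>"
  shows "total_demand w \<rho> a p $ i =
    (\<Sum>j\<in>UNIV. w $ j * (a j $ i powr \<alpha> * p $ i powr (- \<alpha>) / renyi_sum \<alpha> (a j) p))"
proof -
  have "1 - (\<alpha> - 1) / \<alpha> = 1 / \<alpha>" using \<alpha> by (simp add: field_simps)
  then have e: "1 / (1 - (\<alpha> - 1) / \<alpha>) = \<alpha>" "- ((\<alpha> - 1) / \<alpha>) / (1 - (\<alpha> - 1) / \<alpha>) = 1 - \<alpha>"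
    "- 1 / (1 - (\<alpha> - 1) / \<alpha>) = - \<alpha>"
    using \<alpha> by (simp_all only:) (simp_all add: field_simps)
  show ?thesis
    unfolding total_demand_def using \<rho>
    by (simp only: e) (simp add: renyi_sum_def inner_vec_def vpowr_def)
qed

text \<open>Each buyer spends exactly the budget: multiplying by the price raises the exponent
  \<open>- \<alpha>\<close> to \<open>1 - \<alpha>\<close>, and the numerator then sums to the
  denominator.\<close>

lemma price_weighted_demand:
  assumes \<alpha>: "\<alpha> \<in> {0<..<1} \<union> {1<..}" and m: "ces_fisher_market w \<rho> a"
    and \<rho>: "\<forall>j. \<rho> $ j = (\<alpha> - 1) / \<alpha>" and p: "\<And>i. 0 < p $ i"
  shows "(\<Sum>i\<in>UNIV. p $ i * total_demand w \<rho> a p $ i) = 1"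
proof -
  have "0 < \<alpha>" using \<alpha> by auto
  have "(\<Sum>i\<in>UNIV. p $ i * total_demand w \<rho> a p $ i)
    = (\<Sum>j\<in>UNIV. \<Sum>i\<in>UNIV. w $ j * (a j $ i powr \<alpha> * p $ i powr (1 - \<alpha>) / renyi_sum \<alpha> (a j) p))"
    unfolding ces_demand_eq[OF \<rho> \<open>0 < \<alpha>\<close>] sum_distrib_left
  proof (subst sum.swap, intro sum.cong refl)
    fix i j
    have "p $ i powr (1 - \<alpha>) = p $ i * p $ i powr (- \<alpha>)"
      using p[of i] powr_add[of "p $ i" 1 "- \<alpha>"] by simp
    then show "p $ i * (w $ j * (a j $ i powr \<alpha> * p $ i powr (- \<alpha>) / renyi_sum \<alpha> (a j) p)) =
      w $ j * (a j $ i powr \<alpha> * p $ i powr (1 - \<alpha>) / renyi_sum \<alpha> (a j) p)"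
      by simp
  qed
  also have "\<dots> = (\<Sum>j\<in>UNIV. w $ j)"
  proof (rule sum.cong)
    fix j
    have "a j \<in> prob_simplex" using m by (simp add: ces_fisher_market_def)
    then have "0 < renyi_sum \<alpha> (a j) p"
      using renyi_sum_pos[OF \<alpha>] renyi_finite_if_pos p by (metis less_imp_le)
    then show "(\<Sum>i\<in>UNIV. w $ j * (a j $ i powr \<alpha> * p $ i powr (1 - \<alpha>) / renyi_sum \<alpha> (a j) p)) = w $ j"
      by (simp add: renyi_sum_def flip: sum_distrib_left sum_divide_distrib)
  qed simp
  also have "\<dots> = 1" using m by (simp add: ces_fisher_market_def)
  finally show ?thesis .
qed

section \<open>Equilibrium prices minimize the objective\<close>

lemma equilibrium_imp_augustin_mean:
  assumes \<alpha>: "\<alpha> \<in> {0<..<1} \<union> {1<..}" and m: "ces_fisher_market w \<rho> a"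
    and \<rho>: "\<forall>j. \<rho> $ j = (\<alpha> - 1) / \<alpha>" and eq: "equilibrium_price w \<rho> a p"
  shows "is_augustin_mean \<alpha> w a p"
proof -
  have "0 < \<alpha>" using \<alpha> by auto
  have w: "\<forall>j. 0 < w $ j" and a: "\<And>j. a j \<in> prob_simplex"
    using m by (auto simp: ces_fisher_market_def)
  have p: "\<And>i. 0 < p $ i" and x: "\<And>i. total_demand w \<rho> a p $ i = 1"
    using eq by (auto simp: equilibrium_price_def)
  have p1: "(\<Sum>i\<in>UNIV. p $ i) = 1"
    using price_weighted_demand[OF \<alpha> m \<rho> p] x by simp
  have le: "real_objective \<alpha> w a p \<le> real_objective \<alpha> w a q"
    if q: "q \<in> prob_simplex" and fin: "\<And>j. renyi_finite \<alpha> (a j) q" for q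
  proof -
    let ?g = "\<lambda>j i. a j $ i powr \<alpha> * p $ i powr (- \<alpha>) / renyi_sum \<alpha> (a j) p"
    \<comment> \<open>Swapping the sums pairs total demand with \<open>q - p\<close>. At unit demand
      this is a difference of two coordinate sums, both equal to one.\<close>
    have "(\<Sum>j\<in>UNIV. w $ j * (\<Sum>i\<in>UNIV. ?g j i * (q $ i - p $ i)))
      = (\<Sum>i\<in>UNIV. total_demand w \<rho> a p $ i * (q $ i - p $ i))"
      unfolding ces_demand_eq[OF \<rho> \<open>0 < \<alpha>\<close>] sum_distrib_left sum_distrib_right
      by (subst sum.swap) (simp add: mult.assoc)
    also have "\<dots> = 0"
      using p1 prob_simplexD(2)[OF q] x by (simp add: sum_subtractf)
    finally have "real_objective \<alpha> w a p = (\<Sum>j\<in>UNIV. w $ j *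
        (ln (renyi_sum \<alpha> (a j) p) / (\<alpha> - 1) - (\<Sum>i\<in>UNIV. ?g j i * (q $ i - p $ i))))"
      by (simp add: right_diff_distrib sum_subtractf real_objective_def)
    also have "\<dots> \<le> (\<Sum>j\<in>UNIV. w $ j * (ln (renyi_sum \<alpha> (a j) q) / (\<alpha> - 1)))"
      using w by (intro sum_mono mult_left_mono renyi_term_gradient_inequality \<alpha> a p fin
          prob_simplexD(1)[OF q] less_imp_le) auto
    finally show ?thesis by (simp add: real_objective_def)
  qed
  have "\<not> augustin_objective \<alpha> w a q < augustin_objective \<alpha> w a p" if "q \<in> prob_simplex" for q
    using le[OF that] renyi_finite_if_pos[OF a p] by (auto simp: augustin_objective_eq[OF w])
  moreover have "p \<in> prob_simplex"
    using p p1 by (auto simp: prob_simplex_def less_imp_le)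
  ultimately show ?thesis
    by (auto simp: is_augustin_mean_def is_arg_min_def)
qed

section \<open>Finiteness and positivity of minimizers\<close>

text \<open>The uniform vector is a competitor with finite objective.\<close>

lemma augustin_mean_finite:
  assumes m: "ces_fisher_market w \<rho> a" and mean: "is_augustin_mean \<alpha> w a p"
  shows "renyi_finite \<alpha> (a j) p"
proof -
  have w: "\<forall>j. 0 < w $ j" and a: "\<And>j. a j \<in> prob_simplex"
    using m by (auto simp: ces_fisher_market_def)
  define q :: "real ^ 'b" where "q = (\<chi> i. 1 / real CARD('b))"
  have "0 < q $ i" for i by (simp add: q_def)
  then have fin: "\<forall>j. renyi_finite \<alpha> (a j) q" using renyi_finite_if_pos[OF a] by blast
  have "q \<in> prob_simplex" by (simp add: prob_simplex_def q_def)
  then have "\<not> augustin_objective \<alpha> w a q < augustin_objective \<alpha> w a p"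
    using mean by (auto simp: is_augustin_mean_def is_arg_min_def)
  then show ?thesis
    using fin by (auto simp: augustin_objective_eq[OF w] split: if_splits)
qed

text \<open>Real-valued form of minimality, used with the perturbations below.\<close>

lemma augustin_mean_le:
  assumes m: "ces_fisher_market w \<rho> a" and mean: "is_augustin_mean \<alpha> w a p"
    and q: "q \<in> prob_simplex" and fin: "\<And>j. renyi_finite \<alpha> (a j) q"
  shows "real_objective \<alpha> w a p \<le> real_objective \<alpha> w a q"
proof -
  have w: "\<forall>j. 0 < w $ j"
    using m by (auto simp: ces_fisher_market_def)
  have "\<not> augustin_objective \<alpha> w a q < augustin_objective \<alpha> w a p"
    using mean q by (auto simp: is_augustin_mean_def is_arg_min_def)
  then show ?thesis
    using fin augustin_mean_finite[OF m mean] by (auto simp: augustin_objective_eq[OF w])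
qed

text \<open>Near zero the left side is of order \<open>u\<close> and the right side of the larger
  order \<open>u powr s\<close>.\<close>

lemma ln_one_plus_eventually_less:
  fixes s c w :: real
  assumes "0 < s" "s < 1" "0 < c" "0 < w"
  shows "\<forall>\<^sub>F u in at_right 0. s * ln (1 + u) < w * ln (1 + c * u powr s)"
  using assms by real_asymp

lemma augustin_mean_pos:
  assumes \<alpha>: "\<alpha> \<in> {0<..<1} \<union> {1<..}" and m: "ces_fisher_market w \<rho> a"
    and mean: "is_augustin_mean \<alpha> w a p"
  shows "0 < p $ i"
proof (rule ccontr)
  assume "\<not> 0 < p $ i"
  have w: "\<And>j. 0 < w $ j" and w1: "(\<Sum>j\<in>UNIV. w $ j) = 1" and a: "\<And>j. a j \<in> prob_simplex"
    and ai: "0 < (\<Sum>j\<in>UNIV. a j $ i)"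
    using m by (auto simp: ces_fisher_market_def)
  have p: "p \<in> prob_simplex" using mean by (simp add: is_augustin_mean_def is_arg_min_def)
  note p0 = prob_simplexD(1)[OF p]
  from p0[of i] \<open>\<not> 0 < p $ i\<close> have pi: "p $ i = 0" by simp
  obtain k where k: "0 < a k $ i"
    using ai by (metis (no_types, lifting) linorder_not_le sum_nonpos)
  note fin = augustin_mean_finite[OF m mean]
  \<comment> \<open>For \<alpha> > 1 the term of buyer \<open>k\<close> would be infinite.\<close>
  have "\<not> \<alpha> > 1" using fin[of k] k pi by (auto simp: renyi_finite_def)
  then have s01: "0 < 1 - \<alpha>" "1 - \<alpha> < 1" using \<alpha> by auto
  define s where "s = 1 - \<alpha>"
  define c where "c j = a j $ i powr \<alpha> / renyi_sum \<alpha> (a j) p" for j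
  have S: "0 < renyi_sum \<alpha> (a j) p" for j by (rule renyi_sum_pos[OF \<alpha> a p0 fin])
  have c0: "0 \<le> c j" for j using S[of j] by (simp add: c_def)
  have ck: "0 < c k" using S[of k] k by (simp add: c_def)
  have "\<forall>\<^sub>F u in at_right 0. s * ln (1 + u) < w $ k * ln (1 + c k * u powr s) \<and> 0 < u"
    using s01 ck w unfolding s_def
    by (intro eventually_conj ln_one_plus_eventually_less eventually_at_right_less) auto
  then obtain u where u: "s * ln (1 + u) < w $ k * ln (1 + c k * u powr s)" "0 < u"
    using eventually_happens'[OF trivial_limit_at_right_real] by blast
  \<comment> \<open>Mass \<open>u\<close> is placed on the vanishing coordinate, and rescaling
    returns the vector to the simplex.\<close>
  define q :: "real ^ 'b" where "q = (1 / (1 + u)) *\<^sub>R (p + u *\<^sub>R axis i 1)"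
  have "(\<Sum>l\<in>UNIV. q $ l) = (\<Sum>l\<in>UNIV. p $ l + (if l = i then u else 0)) / (1 + u)"
    unfolding sum_divide_distrib by (intro sum.cong) (auto simp: q_def axis_def)
  also have "\<dots> = 1" using u(2) prob_simplexD(2)[OF p] by (simp add: sum.distrib)
  finally have q: "q \<in> prob_simplex"
    using u(2) p0 by (auto simp: prob_simplex_def q_def axis_def)
  \<comment> \<open>Since \<open>p $ i = 0\<close>, the new mass adds a separate term in
    \<open>u powr s\<close>, of relative size \<open>c j\<close>; rescaling acts with homogeneity of
    degree \<open>s\<close>.\<close>
  have Sq: "renyi_sum \<alpha> (a j) q = renyi_sum \<alpha> (a j) p * (1 + c j * u powr s) / (1 + u) powr s" for j
  proof -
    have "a j $ l powr \<alpha> * q $ l powr (1 - \<alpha>) =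
      (a j $ l powr \<alpha> * p $ l powr s + (if l = i then a j $ i powr \<alpha> * u powr s else 0))
        / (1 + u) powr s" for l
      using u(2) p0[of l] pi by (auto simp: q_def axis_def s_def powr_divide)
    then have "renyi_sum \<alpha> (a j) q =
      (renyi_sum \<alpha> (a j) p + a j $ i powr \<alpha> * u powr s) / (1 + u) powr s"
      unfolding renyi_sum_def by (simp add: s_def sum.distrib flip: sum_divide_distrib)
    then show ?thesis using S[of j] by (simp add: c_def distrib_left)
  qed
  have pos: "0 < 1 + c j * u powr s" for j using c0[of j] by (simp add: add_pos_nonneg)
  have lnS: "ln (renyi_sum \<alpha> (a j) q) =
    ln (renyi_sum \<alpha> (a j) p) + ln (1 + c j * u powr s) - s * ln (1 + u)" for j
    unfolding Sq using S[of j] pos[of j] u(2) by (simp add: ln_div ln_mult ln_powr)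
  have "0 < renyi_sum \<alpha> (a j) q" for j
    unfolding Sq using S[of j] pos[of j] u(2) by simp
  then have "renyi_finite \<alpha> (a j) q" for j
    using \<open>\<not> \<alpha> > 1\<close> by (auto simp: renyi_finite_def less_le)
  then have le: "real_objective \<alpha> w a p \<le> real_objective \<alpha> w a q"
    by (rule augustin_mean_le[OF m mean q])
  \<comment> \<open>Multiplication by \<open>s = 1 - \<alpha>\<close> turns minimality of the
    objective into maximality of the weighted sum of logarithms.\<close>
  have "s * real_objective \<alpha> w a r = - (\<Sum>j\<in>UNIV. w $ j * ln (renyi_sum \<alpha> (a j) r))" for r
    unfolding real_objective_def sum_distrib_left sum_negf[symmetric]
    using s01 by (intro sum.cong refl) (simp add: s_def field_simps)
  moreover have "s * real_objective \<alpha> w a p \<le> s * real_objective \<alpha> w a q"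
    using le s01 by (simp add: s_def)
  ultimately have "(\<Sum>j\<in>UNIV. w $ j * ln (renyi_sum \<alpha> (a j) q))
      \<le> (\<Sum>j\<in>UNIV. w $ j * ln (renyi_sum \<alpha> (a j) p))" by simp
  then have "(\<Sum>j\<in>UNIV. w $ j * ln (1 + c j * u powr s)) \<le> s * ln (1 + u) * (\<Sum>j\<in>UNIV. w $ j)"
    unfolding lnS by (simp add: algebra_simps sum.distrib sum_subtractf sum_distrib_left sum_distrib_right)
  \<comment> \<open>All gains are nonnegative, so that of buyer \<open>k\<close> alone already
    exceeds the rescaling cost.\<close>
  moreover have "w $ k * ln (1 + c k * u powr s) \<le> (\<Sum>j\<in>UNIV. w $ j * ln (1 + c j * u powr s))"
    using w c0 by (intro member_le_sum) (auto intro!: mult_nonneg_nonneg simp: less_imp_le)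
  ultimately show False using u(1) w1 by simp
qed

section \<open>Stationarity of a positive minimizer\<close>

lemma augustin_mean_imp_equilibrium:
  assumes \<alpha>: "\<alpha> \<in> {0<..<1} \<union> {1<..}" and m: "ces_fisher_market w \<rho> a"
    and \<rho>: "\<forall>j. \<rho> $ j = (\<alpha> - 1) / \<alpha>" and mean: "is_augustin_mean \<alpha> w a p"
  shows "equilibrium_price w \<rho> a p"
proof -
  have "0 < \<alpha>" "\<alpha> \<noteq> 1" using \<alpha> by auto
  have a: "\<And>j. a j \<in> prob_simplex"
    using m by (auto simp: ces_fisher_market_def)
  have p: "p \<in> prob_simplex" using mean by (simp add: is_augustin_mean_def is_arg_min_def)
  have ppos: "\<And>i. 0 < p $ i" by (rule augustin_mean_pos[OF \<alpha> m mean])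
  define x where "x = total_demand w \<rho> a p"
  \<comment> \<open>tangent to the simplex by Walras' law\<close>
  define v :: "real ^ 'b" where "v = (\<chi> i. p $ i * (x $ i - 1))"
  have v0: "(\<Sum>i\<in>UNIV. v $ i) = 0"
    using price_weighted_demand[OF \<alpha> m \<rho> ppos] prob_simplexD(2)[OF p]
    by (simp add: v_def x_def right_diff_distrib sum_subtractf)
  have S: "0 < renyi_sum \<alpha> (a j) p" for j
    using renyi_sum_pos[OF \<alpha> a] renyi_finite_if_pos[OF a ppos] ppos by (simp add: less_imp_le)
  have dS: "((\<lambda>t. renyi_sum \<alpha> (a j) (p + t *\<^sub>R v)) has_real_derivative
      (1 - \<alpha>) * (\<Sum>i\<in>UNIV. a j $ i powr \<alpha> * p $ i powr (- \<alpha>) * v $ i)) (at 0)" for j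
    unfolding renyi_sum_def sum_distrib_left
  proof (rule DERIV_sum)
    fix i
    show "((\<lambda>t. a j $ i powr \<alpha> * (p + t *\<^sub>R v) $ i powr (1 - \<alpha>)) has_real_derivative
       (1 - \<alpha>) * (a j $ i powr \<alpha> * p $ i powr (- \<alpha>) * v $ i)) (at 0)"
      using ppos[of i] by (auto intro!: derivative_eq_intros)
  qed
  have "((\<lambda>t. real_objective \<alpha> w a (p + t *\<^sub>R v)) has_real_derivative
      (\<Sum>j\<in>UNIV. w $ j / (\<alpha> - 1) * (((1 - \<alpha>) * (\<Sum>i\<in>UNIV. a j $ i powr \<alpha> * p $ i powr (- \<alpha>) * v $ i))
        / renyi_sum \<alpha> (a j) p))) (at 0)"
    unfolding real_objective_def
  proof (intro DERIV_sum DERIV_cmult)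
    fix j
    show "((\<lambda>t. ln (renyi_sum \<alpha> (a j) (p + t *\<^sub>R v))) has_real_derivative
      ((1 - \<alpha>) * (\<Sum>i\<in>UNIV. a j $ i powr \<alpha> * p $ i powr (- \<alpha>) * v $ i))
        / renyi_sum \<alpha> (a j) p) (at 0)"
      using S[of j] by (auto intro!: derivative_eq_intros dS)
  qed
  also have "(\<Sum>j\<in>UNIV. w $ j / (\<alpha> - 1) * (((1 - \<alpha>) * (\<Sum>i\<in>UNIV. a j $ i powr \<alpha> * p $ i powr (- \<alpha>) * v $ i))
        / renyi_sum \<alpha> (a j) p))
    = (\<Sum>j\<in>UNIV. - (w $ j * ((\<Sum>i\<in>UNIV. a j $ i powr \<alpha> * p $ i powr (- \<alpha>) * v $ i)
        / renyi_sum \<alpha> (a j) p)))"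
  proof (rule sum.cong)
    fix j
    have "W / (\<alpha> - 1) * (((1 - \<alpha>) * X) / Y) = - (W * (X / Y))" for W X Y :: real
      using \<open>\<alpha> \<noteq> 1\<close> by (cases "Y = 0") (auto simp: field_simps)
    then show "w $ j / (\<alpha> - 1) * (((1 - \<alpha>) * (\<Sum>i\<in>UNIV. a j $ i powr \<alpha> * p $ i powr (- \<alpha>) * v $ i))
        / renyi_sum \<alpha> (a j) p)
      = - (w $ j * ((\<Sum>i\<in>UNIV. a j $ i powr \<alpha> * p $ i powr (- \<alpha>) * v $ i)
        / renyi_sum \<alpha> (a j) p))" .
  qed simp
  also have "\<dots> = - (\<Sum>i\<in>UNIV. x $ i * v $ i)"
    unfolding x_def ces_demand_eq[OF \<rho> \<open>0 < \<alpha>\<close>] sum_negf sum_distrib_left sum_distrib_right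
      sum_divide_distrib
    by (subst sum.swap) (simp add: mult.assoc)
  also have "\<dots> = - (\<Sum>i\<in>UNIV. p $ i * (x $ i - 1)\<^sup>2)"
  proof -
    \<comment> \<open>Subtracting the zero sum of \<open>v\<close> replaces \<open>x\<close> by
      \<open>x - 1\<close> and produces the squares.\<close>
    have "(\<Sum>i\<in>UNIV. x $ i * v $ i) = (\<Sum>i\<in>UNIV. x $ i * v $ i) - (\<Sum>i\<in>UNIV. v $ i)"
      by (simp add: v0)
    also have "\<dots> = (\<Sum>i\<in>UNIV. p $ i * (x $ i - 1)\<^sup>2)"
      by (simp add: v_def power2_eq_square algebra_simps flip: sum_subtractf)
    finally show ?thesis by simp
  qed
  finally have deriv: "((\<lambda>t. real_objective \<alpha> w a (p + t *\<^sub>R v)) has_real_derivative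
    - (\<Sum>i\<in>UNIV. p $ i * (x $ i - 1)\<^sup>2)) (at 0)" .
  \<comment> \<open>Positivity persists for small \<open>t\<close> of either sign, so 0 is a
    two-sided local minimum along the line and the derivative there vanishes.\<close>
  have "\<forall>\<^sub>F t in nhds 0. 0 < (p + t *\<^sub>R v) $ i" for i
  proof (rule order_tendstoD(1))
    show "((\<lambda>t. (p + t *\<^sub>R v) $ i) \<longlongrightarrow> p $ i) (nhds 0)"
      by (auto intro!: tendsto_eq_intros filterlim_ident)
  qed (rule ppos)
  then have "\<forall>\<^sub>F t in nhds 0. \<forall>i. 0 < (p + t *\<^sub>R v) $ i"
    by (rule eventually_all_finite)
  then obtain d where d: "0 < d" "\<And>t i. \<bar>t\<bar> < d \<Longrightarrow> 0 < (p + t *\<^sub>R v) $ i"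
    unfolding eventually_nhds_metric by (auto simp: dist_real_def)
  have "real_objective \<alpha> w a p \<le> real_objective \<alpha> w a (p + t *\<^sub>R v)" if t: "\<bar>t\<bar> < d" for t
  proof (rule augustin_mean_le[OF m mean])
    show "renyi_finite \<alpha> (a j) (p + t *\<^sub>R v)" for j
      by (rule renyi_finite_if_pos[OF a d(2)[OF t]])
    have "(\<Sum>i\<in>UNIV. (p + t *\<^sub>R v) $ i) = 1"
      using prob_simplexD(2)[OF p] v0 by (simp add: sum.distrib flip: sum_distrib_left)
    then show "p + t *\<^sub>R v \<in> prob_simplex"
      using d(2)[OF t] by (simp only: prob_simplex_def mem_Collect_eq less_imp_le simp_thms)
  qed
  then have "- (\<Sum>i\<in>UNIV. p $ i * (x $ i - 1)\<^sup>2) = 0"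
    using DERIV_local_min[OF deriv d(1)] by simp
  then have "\<forall>i. p $ i * (x $ i - 1)\<^sup>2 = 0"
    using ppos by (simp add: sum_nonneg_eq_0_iff less_imp_le)
  then have "x = 1"
    using ppos by (auto simp: vec_eq_iff less_le)
  then show ?thesis using ppos by (simp add: equilibrium_price_def x_def)
qed

theorem mainTheorem4:
  fixes \<alpha> :: real
    and w \<rho> :: "real ^ 'n"
    and a :: "'n \<Rightarrow> real ^ 'd"
    and p_star :: "real ^ 'd"
  assumes "\<alpha> \<in> {0<..<1} \<union> {1<..}"
    and "ces_fisher_market w \<rho> a"
    and "\<forall>j. \<rho> $ j = (\<alpha> - 1) / \<alpha>"
  shows "equilibrium_price w \<rho> a p_star \<longleftrightarrow> is_augustin_mean \<alpha> w a p_star"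
  using equilibrium_imp_augustin_mean[OF assms] augustin_mean_imp_equilibrium[OF assms] by blast

end
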